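(* Let $\varepsilon>0$ and consider the generalized Liénard system $$\varepsilon\dot x=y-F(x),\qquad \dot y=-g(x),$$ where $F(x)=\int_0^x f(s)\,ds$, $f$ and $g$ satisfy the assumptions (I)–(IV) listed in the context, and $g$ is continuously differentiable. Let $G(x)=\int_0^x g(s)\,ds$, and along solutions of the system define the flow curvature function $$\phi(x,y,\varepsilon)=\det(\ddot{\vec X},\dot{\vec X})=\ddot x\,\dot y-\ddot y\,\dot x,\qquad \vec X=(x,y)^t,$$ and the energy $$E=\frac{\varepsilon\dot x^2}{2}+G(x).$$ Then the flow curvature and the energy are related by $$\varepsilon\,\phi(x,y,\varepsilon)=2g'(x)\,E+H-f(x)\,\dot x\,\dot y,\qquad\text{where } H=\dot y^2-2g'(x)G(x).$$
   Context: Dots denote derivatives with respect to time along solutions of the system, so that $\dot x=\frac1\varepsilon(y-F(x))$ and $\dot y=-g(x)$, and $\ddot x,\ddot y$ are the derivatives of these along solutions. For vectors $\vec a,\vec b\in\mathbb{R}^2$, $\det(\vec a,\vec b)=a_1b_2-a_2b_1$. Standing assumptions on $f,g:\mathbb{R}\to\mathbb{R}$ and $F$: (I) $f$ is even, $g$ is odd, $x\,g(x)>0$ for all $x\neq0$, and $f(0)<0$; (II) $f$ and $g$ are continuous for all $x$, and $g$ satisfies a Lipschitz condition for all $x$; (III) $F(x)\to\pm\infty$ as $x\to\pm\infty$; (IV) $F$ has a single positive zero $x=a$ and is monotone increasing for $x\geqslant a$. *)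

theory Defs
  imports "HOL-Analysis.Analysis"
begin

text \<open>The integral is oriented, so that it is the negative of the integral over \<open>[x, 0]\<close>
  for negative \<open>x\<close>.\<close>

definition primitive :: "(real \<Rightarrow> real) \<Rightarrow> real \<Rightarrow> real" where
  "primitive h x = (LBINT s=0..ereal x. h s)"

definition lienard_assumptions :: "(real \<Rightarrow> real) \<Rightarrow> (real \<Rightarrow> real) \<Rightarrow> real \<Rightarrow> bool" where
  "lienard_assumptions f g a \<longleftrightarrow>
     ((\<forall>x. f (- x) = f x) \<and> (\<forall>x. g (- x) = - g x) \<and> (\<forall>x. x \<noteq> 0 \<longrightarrow> x * g x > 0) \<and> f 0 < 0) \<and>
     (continuous_on UNIV f \<and> continuous_on UNIV g \<and> (\<exists>L. L-lipschitz_on UNIV g)) \<and>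
     (filterlim (primitive f) at_top at_top \<and> filterlim (primitive f) at_bot at_bot) \<and>
     (a > 0 \<and> primitive f a = 0 \<and> (\<forall>x>0. primitive f x = 0 \<longrightarrow> x = a) \<and>
      mono_on {a..} (primitive f))"

definition velocity :: "(real \<Rightarrow> real^2) \<Rightarrow> real \<Rightarrow> real^2" where
  "velocity X t = vector_derivative X (at t)"

definition acceleration :: "(real \<Rightarrow> real^2) \<Rightarrow> real \<Rightarrow> real^2" where
  "acceleration X t = vector_derivative (velocity X) (at t)"

text \<open>A solution is a curve \<open>X = (x, y)\<close>, on an open time interval \<open>T\<close>, with
  \<open>\<epsilon> x' = y - F(x)\<close> and \<open>y' = - g(x)\<close>.\<close>

definition lienard_solution ::
    "(real \<Rightarrow> real) \<Rightarrow> (real \<Rightarrow> real) \<Rightarrow> real \<Rightarrow> real set \<Rightarrow> (real \<Rightarrow> real^2) \<Rightarrow> bool" where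
  "lienard_solution f g \<epsilon> T X \<longleftrightarrow>
     open T \<and> is_interval T \<and>
     (\<forall>t\<in>T. X differentiable (at t) \<and>
        \<epsilon> * velocity X t $ 1 = X t $ 2 - primitive f (X t $ 1) \<and>
        velocity X t $ 2 = - g (X t $ 1))"

definition det2 :: "real^2 \<Rightarrow> real^2 \<Rightarrow> real" where
  "det2 u v = u $ 1 * v $ 2 - u $ 2 * v $ 1"

text \<open>The value of \<open>\<phi>(x, y, \<epsilon>)\<close> at the point \<open>(x, y) = X t\<close>; the dependence on
  \<open>\<epsilon>\<close> is through the solution \<open>X\<close>.\<close>

definition flow_curvature :: "(real \<Rightarrow> real^2) \<Rightarrow> real \<Rightarrow> real" where
  "flow_curvature X t = det2 (acceleration X t) (velocity X t)"

definition energy :: "(real \<Rightarrow> real) \<Rightarrow> real \<Rightarrow> (real \<Rightarrow> real^2) \<Rightarrow> real \<Rightarrow> real" where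
  "energy g \<epsilon> X t = \<epsilon> * (velocity X t $ 1)\<^sup>2 / 2 + primitive g (X t $ 1)"

end

theory Submission
  imports Defs
begin

text \<open>Along a solution the velocity is itself a differentiable function of the position:
  \<open>x' = (y - F(x)) / \<epsilon>\<close> and \<open>y' = - g(x)\<close>. Since \<open>F\<close> is a primitive of the continuous
  function \<open>f\<close>, the chain rule gives
  \<open>\<epsilon> x'' = y' - f(x) x'\<close> and \<open>y'' = - g'(x) x'\<close>, so that
  \<open>\<epsilon> (x'' y' - y'' x') = y'\<^sup>2 - f(x) x' y' + g'(x) \<epsilon> x'\<^sup>2\<close>.
  The last term is the kinetic part of \<open>2 g'(x) E\<close>, because \<open>\<epsilon> x'\<^sup>2 = 2 (E - G(x))\<close>;
  collecting the terms with \<open>G\<close> into \<open>H\<close> gives the formula.\<close>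

lemma primitive_has_real_derivative:
  assumes "continuous_on UNIV h"
  shows "(primitive h has_real_derivative h x) (at x)"
proof -
  define l u where "l = min 0 x - 1" and "u = max 0 x + 1"
  have "((\<lambda>v. LBINT s=ereal 0..v. h s) has_vector_derivative h x) (at x within {l..u})"
    by (rule interval_integral_FTC2)
      (auto simp: l_def u_def intro: continuous_on_subset[OF assms])
  moreover have "at x within {l..u} = at x"
    by (rule at_within_interior) (auto simp: l_def u_def)
  ultimately show ?thesis
    unfolding primitive_def[abs_def] has_real_derivative_iff_has_vector_derivative
    by (simp add: zero_ereal_def)
qed

lemma has_vector_derivative_vec_nth:
  "(X has_vector_derivative v) F \<Longrightarrow> ((\<lambda>s. X s $ i) has_vector_derivative v $ i) F"
  by (rule bounded_linear.has_vector_derivative[OF bounded_linear_vec_nth])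

lemma has_vector_derivative_vector_2:
  fixes u v :: "real \<Rightarrow> real"
  assumes "(u has_vector_derivative u') F" and "(v has_vector_derivative v') F"
  shows "((\<lambda>s. vector [u s, v s] :: real^2) has_vector_derivative vector [u', v']) F"
proof -
  have vec: "vector [p, q] = p *\<^sub>R axis 1 1 + q *\<^sub>R (axis 2 1 :: real^2)" for p q :: real
    by (simp add: vec_eq_iff forall_2 axis_def)
  show ?thesis
    unfolding vec
    by (intro has_vector_derivative_add
        bounded_linear.has_vector_derivative[OF bounded_linear_scaleR_left] assms)
qed

text \<open>The equations of the system hold on the whole open set \<open>T\<close>, so they can be
  differentiated at \<open>t\<close>; this also yields that the second derivative exists.\<close>

lemma acceleration_lienard_solution:
  assumes "\<epsilon> \<noteq> 0" and "continuous_on UNIV f" and "g differentiable (at (X t $ 1))"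
    and sol: "lienard_solution f g \<epsilon> T X" and "t \<in> T"
  shows "\<epsilon> * acceleration X t $ 1 = velocity X t $ 2 - f (X t $ 1) * velocity X t $ 1"
    and "acceleration X t $ 2 = - deriv g (X t $ 1) * velocity X t $ 1"
proof -
  let ?x = "\<lambda>s. X s $ 1" and ?y = "\<lambda>s. X s $ 2"
  have "(X has_vector_derivative velocity X t) (at t)"
    using sol \<open>t \<in> T\<close> by (auto simp: lienard_solution_def velocity_def vector_derivative_works)
  then have dx: "(?x has_real_derivative velocity X t $ 1) (at t)"
    and dy: "(?y has_real_derivative velocity X t $ 2) (at t)"
    by (auto simp: has_real_derivative_iff_has_vector_derivative
        intro: has_vector_derivative_vec_nth)
  have dg: "(g has_real_derivative deriv g (?x t)) (at (?x t))"
    using assms(3) by (simp add: DERIV_deriv_iff_real_differentiable)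
  have d1: "((\<lambda>s. (?y s - primitive f (?x s)) / \<epsilon>) has_real_derivative
      (velocity X t $ 2 - f (?x t) * velocity X t $ 1) / \<epsilon>) (at t)"
    by (intro DERIV_cdivide DERIV_diff dy
        DERIV_chain2[OF primitive_has_real_derivative[OF assms(2)] dx])
  have d2: "((\<lambda>s. - g (?x s)) has_real_derivative - (deriv g (?x t) * velocity X t $ 1)) (at t)"
    by (intro DERIV_minus DERIV_chain2[OF dg dx])
  let ?A = "vector [(velocity X t $ 2 - f (?x t) * velocity X t $ 1) / \<epsilon>,
                    - (deriv g (?x t) * velocity X t $ 1)] :: real^2"
  have "((\<lambda>s. vector [(?y s - primitive f (?x s)) / \<epsilon>, - g (?x s)] :: real^2)
      has_vector_derivative ?A) (at t)"
    using d1 d2 by (intro has_vector_derivative_vector_2)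
      (simp_all add: has_real_derivative_iff_has_vector_derivative)
  moreover have "vector [(?y s - primitive f (?x s)) / \<epsilon>, - g (?x s)] = velocity X s"
    if "s \<in> T" for s
    using sol that \<open>\<epsilon> \<noteq> 0\<close>
    by (auto simp: lienard_solution_def vec_eq_iff forall_2 field_simps)
  ultimately have "(velocity X has_vector_derivative ?A) (at t)"
    using sol \<open>t \<in> T\<close> has_vector_derivative_transform_within_open
    unfolding lienard_solution_def by blast
  then have "acceleration X t = ?A"
    unfolding acceleration_def by (rule vector_derivative_at)
  then show "\<epsilon> * acceleration X t $ 1 = velocity X t $ 2 - f (X t $ 1) * velocity X t $ 1"
    and "acceleration X t $ 2 = - deriv g (X t $ 1) * velocity X t $ 1"
    using \<open>\<epsilon> \<noteq> 0\<close> by simp_all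
qed

theorem mainTheorem2:
  fixes f g :: "real \<Rightarrow> real" and a \<epsilon> t :: real and T :: "real set" and X :: "real \<Rightarrow> real^2"
  assumes "\<epsilon> > 0"
    and "lienard_assumptions f g a"
    and "g C1_differentiable_on UNIV"
    and "lienard_solution f g \<epsilon> T X"
    and "t \<in> T"
  shows "let x = X t $ 1; xdot = velocity X t $ 1; ydot = velocity X t $ 2;
             H = ydot\<^sup>2 - 2 * deriv g x * primitive g x
         in \<epsilon> * flow_curvature X t = 2 * deriv g x * energy g \<epsilon> X t + H - f x * xdot * ydot"
proof -
  have "g differentiable (at (X t $ 1))"
    using assms(3) by (simp add: C1_differentiable_on_eq)
  then have acc:
    "\<epsilon> * acceleration X t $ 1 = velocity X t $ 2 - f (X t $ 1) * velocity X t $ 1"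
    "acceleration X t $ 2 = - deriv g (X t $ 1) * velocity X t $ 1"
    using acceleration_lienard_solution[of \<epsilon> f g X t T] assms
    by (auto simp: lienard_assumptions_def)
  have "\<epsilon> * flow_curvature X t =
      (\<epsilon> * acceleration X t $ 1) * velocity X t $ 2 - \<epsilon> * acceleration X t $ 2 * velocity X t $ 1"
    by (simp add: flow_curvature_def det2_def algebra_simps)
  then show ?thesis
    unfolding acc by (simp add: Let_def energy_def power2_eq_square algebra_simps)
qed

end
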